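(* Let $\tau,\sigma>0$ and $\mu\in\mathbb{R}$, and let $\widetilde Y(t_i)$, $t_i=i\Delta$, be any one of the six numerical solutions L1, L2, S1, S2 (splitting schemes), Lin (piecewise linear scheme), Log (log-ODE scheme) of the inhomogeneous geometric Brownian motion, with recursions given in the context. Then for every choice of the time step $\Delta>0$ the scheme fulfils all of the following properties: (a) Discrete unattainable property: if $\mu\ge0$, then $\mathbb{P}(\widetilde Y(t_i)>0\,|\,\widetilde Y(t_{i-1})>0)=1$. (b) Discrete absorbing property: if $\mu=0$, then $\mathbb{P}(\widetilde Y(t_1)=0\,|\,Y_0=0)=1$. (c) Discrete entrance property: if $\mu>0$, then $\mathbb{P}(\widetilde Y(t_1)>0\,|\,Y_0=0)=1$. (d) Discrete exit property: if $\mu<0$, then $\mathbb{P}(\widetilde Y(t_i)<0\,|\,\widetilde Y(t_{i-1})\le0)=1$.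
   Context: The inhomogeneous geometric Brownian motion is the solution of the Itô SDE $dY(t)=(-\frac1\tau Y(t)+\mu)dt+\sigma Y(t)dW(t)$, $Y(0)=Y_0$. Let $t_i=i\Delta$, $i\ge 1$. The variables $\xi_0,\xi_1,\dots$ are iid $N(0,\Delta)$ (Wiener increments); $\rho_0,\rho_1,\dots$ are iid $N(0,\Delta/12)$ and independent of the $\xi$'s; $\varphi_0,\psi_0,\varphi_1,\psi_1,\dots$ are iid $N(0,\Delta/2)$; all are independent of $Y_0$. Put $a=\frac1\tau+\frac{\sigma^2}{2}$ and $X_{i-1}=e^{-a\Delta+\sigma\xi_{i-1}}$, and $\alpha_{i-1}=\dfrac{e^{-a\Delta+\sigma\xi_{i-1}}-1}{-a\Delta+\sigma\xi_{i-1}}$ (the denominator is nonzero almost surely). All schemes start at $\widetilde Y(t_0)=Y_0$ and, writing $y=\widetilde Y(t_{i-1})$ for the same scheme, are defined for $i\ge1$ by: L1 (first Lie-Trotter): $\widetilde Y(t_i)=X_{i-1}(y+\mu\Delta)$. L2 (second Lie-Trotter): $\widetilde Y(t_i)=yX_{i-1}+\mu\Delta$. S1 (first Strang): $\widetilde Y(t_i)=(y+\mu\frac\Delta2)X_{i-1}+\mu\frac\Delta2$. S2 (second Strang): $\widetilde Y(t_i)=y\,e^{-a\Delta+\sigma(\varphi_{i-1}+\psi_{i-1})}+\mu\Delta\,e^{-a\Delta/2+\sigma\psi_{i-1}}$. Lin (piecewise linear): $\widetilde Y(t_i)=yX_{i-1}+\mu\Delta\,\alpha_{i-1}$. Log (log-ODE):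 $\widetilde Y(t_i)=yX_{i-1}+\mu\Delta\,\alpha_{i-1}\left(1-\sigma\rho_{i-1}+\sigma^2\left(\frac35\rho_{i-1}^2+\frac{\Delta}{30}\right)\right)$. The conditional probabilities are to be read as one-step transition statements: for every fixed value $y$ of the previous state (respectively of $Y_0$) satisfying the condition after the bar, the next value produced by the recursion from $y$ satisfies the stated relation with probability $1$. *)

theory Defs
  imports "HOL-Probability.Probability"
begin

datatype igbm_scheme = L1 | L2 | S1 | S2 | Lin | Log

definition igbm_X :: "real \<Rightarrow> real \<Rightarrow> real \<Rightarrow> real \<Rightarrow> real" where
  "igbm_X \<tau> \<sigma> \<Delta> x = exp (- (1 / \<tau> + \<sigma>\<^sup>2 / 2) * \<Delta> + \<sigma> * x)"

(* If the denominator vanishes, the value is 0 by the convention 0 / 0 = 0;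
   for a Gaussian increment x this happens with probability 0. *)
definition igbm_alpha :: "real \<Rightarrow> real \<Rightarrow> real \<Rightarrow> real \<Rightarrow> real" where
  "igbm_alpha \<tau> \<sigma> \<Delta> x =
     (exp (- (1 / \<tau> + \<sigma>\<^sup>2 / 2) * \<Delta> + \<sigma> * x) - 1) / (- (1 / \<tau> + \<sigma>\<^sup>2 / 2) * \<Delta> + \<sigma> * x)"

(* One step of the recursion from the state y, where x, r, p, q are the values of the
   noise variables xi, rho, phi, psi belonging to this step. *)
fun igbm_step ::
  "igbm_scheme \<Rightarrow> real \<Rightarrow> real \<Rightarrow> real \<Rightarrow> real \<Rightarrow> real \<Rightarrow> real \<Rightarrow> real \<Rightarrow> real \<Rightarrow> real \<Rightarrow> real" where
  "igbm_step L1 \<tau> \<mu> \<sigma> \<Delta> x r p q y = igbm_X \<tau> \<sigma> \<Delta> x * (y + \<mu> * \<Delta>)"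
| "igbm_step L2 \<tau> \<mu> \<sigma> \<Delta> x r p q y = y * igbm_X \<tau> \<sigma> \<Delta> x + \<mu> * \<Delta>"
| "igbm_step S1 \<tau> \<mu> \<sigma> \<Delta> x r p q y =
     (y + \<mu> * (\<Delta> / 2)) * igbm_X \<tau> \<sigma> \<Delta> x + \<mu> * (\<Delta> / 2)"
| "igbm_step S2 \<tau> \<mu> \<sigma> \<Delta> x r p q y =
     y * exp (- (1 / \<tau> + \<sigma>\<^sup>2 / 2) * \<Delta> + \<sigma> * (p + q))
     + \<mu> * \<Delta> * exp (- (1 / \<tau> + \<sigma>\<^sup>2 / 2) * \<Delta> / 2 + \<sigma> * q)"
| "igbm_step Lin \<tau> \<mu> \<sigma> \<Delta> x r p q y =
     y * igbm_X \<tau> \<sigma> \<Delta> x + \<mu> * \<Delta> * igbm_alpha \<tau> \<sigma> \<Delta> x"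
| "igbm_step Log \<tau> \<mu> \<sigma> \<Delta> x r p q y =
     y * igbm_X \<tau> \<sigma> \<Delta> x
     + \<mu> * \<Delta> * igbm_alpha \<tau> \<sigma> \<Delta> x * (1 - \<sigma> * r + \<sigma>\<^sup>2 * (3 / 5 * r\<^sup>2 + \<Delta> / 30))"

(* The random value at time (i + 1) * \<Delta> produced by the recursion from the value y at time i * \<Delta>. *)
definition igbm_next ::
  "igbm_scheme \<Rightarrow> real \<Rightarrow> real \<Rightarrow> real \<Rightarrow> real \<Rightarrow> (nat \<Rightarrow> 'a \<Rightarrow> real) \<Rightarrow> (nat \<Rightarrow> 'a \<Rightarrow> real) \<Rightarrow>
   (nat \<Rightarrow> 'a \<Rightarrow> real) \<Rightarrow> (nat \<Rightarrow> 'a \<Rightarrow> real) \<Rightarrow> nat \<Rightarrow> real \<Rightarrow> 'a \<Rightarrow> real" where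
  "igbm_next s \<tau> \<mu> \<sigma> \<Delta> \<xi> \<rho> \<phi> \<psi> i y \<omega> =
     igbm_step s \<tau> \<mu> \<sigma> \<Delta> (\<xi> i \<omega>) (\<rho> i \<omega>) (\<phi> i \<omega>) (\<psi> i \<omega>) y"

primrec igbm_numsol ::
  "igbm_scheme \<Rightarrow> real \<Rightarrow> real \<Rightarrow> real \<Rightarrow> real \<Rightarrow> (nat \<Rightarrow> 'a \<Rightarrow> real) \<Rightarrow> (nat \<Rightarrow> 'a \<Rightarrow> real) \<Rightarrow>
   (nat \<Rightarrow> 'a \<Rightarrow> real) \<Rightarrow> (nat \<Rightarrow> 'a \<Rightarrow> real) \<Rightarrow> ('a \<Rightarrow> real) \<Rightarrow> nat \<Rightarrow> 'a \<Rightarrow> real" where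
  "igbm_numsol s \<tau> \<mu> \<sigma> \<Delta> \<xi> \<rho> \<phi> \<psi> Y0 0 \<omega> = Y0 \<omega>"
| "igbm_numsol s \<tau> \<mu> \<sigma> \<Delta> \<xi> \<rho> \<phi> \<psi> Y0 (Suc i) \<omega> =
     igbm_next s \<tau> \<mu> \<sigma> \<Delta> \<xi> \<rho> \<phi> \<psi> i (igbm_numsol s \<tau> \<mu> \<sigma> \<Delta> \<xi> \<rho> \<phi> \<psi> Y0 i \<omega>) \<omega>"

(* The second argument of normal_density is the standard deviation. The pair (xi, rho) is not
   required to be independent of the pair (phi, psi): no scheme uses both. Independence of Y0
   means independence of the sigma-algebra generated by all noise variables together; it is
   phrased with indep_set since indep_var needs random variables of equal type. *)
locale igbm_noise = prob_space M
  for M :: "'a measure" and \<Delta> :: real and Y0 :: "'a \<Rightarrow> real"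
    and \<xi> \<rho> \<phi> \<psi> :: "nat \<Rightarrow> 'a \<Rightarrow> real" +
  assumes xi_normal: "\<And>i. distributed M lborel (\<xi> i) (normal_density 0 (sqrt \<Delta>))"
    and rho_normal: "\<And>i. distributed M lborel (\<rho> i) (normal_density 0 (sqrt (\<Delta> / 12)))"
    and phi_normal: "\<And>i. distributed M lborel (\<phi> i) (normal_density 0 (sqrt (\<Delta> / 2)))"
    and psi_normal: "\<And>i. distributed M lborel (\<psi> i) (normal_density 0 (sqrt (\<Delta> / 2)))"
    and xi_rho_indep: "indep_vars (\<lambda>_. borel) (case_sum \<xi> \<rho>) UNIV"
    and phi_psi_indep: "indep_vars (\<lambda>_. borel) (case_sum \<phi> \<psi>) UNIV"
    and Y0_measurable: "Y0 \<in> borel_measurable M"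
    and Y0_indep: "indep_set
      (sets (vimage_algebra (space M) Y0 borel))
      (sets (vimage_algebra (space M)
        (\<lambda>\<omega> j. case_sum (case_sum \<xi> \<rho>) (case_sum \<phi> \<psi>) j \<omega>) (\<Pi>\<^sub>M j\<in>UNIV. borel)))"

end

theory Submission
  imports Defs
begin

text \<open>Every scheme has the form \<open>y' = A y + \<mu> B\<close> with \<open>A > 0\<close> and \<open>B > 0\<close>, so the sign of
  \<open>y'\<close> is determined by the signs of \<open>y\<close> and \<open>\<mu>\<close>. Positivity of \<open>B\<close> uses that
  \<open>(exp x - 1) / x > 0\<close> for \<open>x \<noteq> 0\<close> and, for the log-ODE scheme, that the polynomial
  \<open>1 - z + 3/5 z\<^sup>2\<close> has negative discriminant.\<close>

text \<open>\<open>exp\<close> is strictly increasing with value 1 at 0, so numerator and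
  denominator share their sign.\<close>

lemma exp_minus_one_quotient_pos:
  fixes x :: real
  assumes "x \<noteq> 0"
  shows "(exp x - 1) / x > 0"
  using assms by (cases "x > 0") (auto simp: zero_less_divide_iff)

lemma log_ode_factor_pos:
  fixes \<sigma> r \<Delta> :: real
  assumes "\<Delta> > 0"
  shows "1 - \<sigma> * r + \<sigma>\<^sup>2 * (3 / 5 * r\<^sup>2 + \<Delta> / 30) > 0"
proof -
  \<comment> \<open>Completing the square in z = \<open>\<sigma> * r\<close>: the quadratic part has
    its vertex at 5/6, with minimum 1 - 5/12 = 7/12.\<close>
  have "1 - \<sigma> * r + \<sigma>\<^sup>2 * (3 / 5 * r\<^sup>2 + \<Delta> / 30)
      = 3 / 5 * (\<sigma> * r - 5 / 6)\<^sup>2 + 7 / 12 + \<sigma>\<^sup>2 * (\<Delta> / 30)"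
    by (simp add: power2_eq_square field_simps)
  moreover have "0 \<le> \<sigma>\<^sup>2 * (\<Delta> / 30)"
    using assms by simp
  ultimately show ?thesis
    using zero_le_power2[of "\<sigma> * r - 5 / 6"] by linarith
qed

text \<open>The nonzero exponent matters for \<open>Lin\<close> and \<open>Log\<close>: at exponent
  0 the convention 0 / 0 = 0 makes \<open>igbm_alpha\<close> vanish, and with it
  \<open>B\<close>.\<close>

lemma igbm_step_affine:
  assumes "\<Delta> > 0" and "- (1 / \<tau> + \<sigma>\<^sup>2 / 2) * \<Delta> + \<sigma> * x \<noteq> 0"
  obtains A B where "A > 0" "B > 0"
    "\<And>\<mu> y. igbm_step s \<tau> \<mu> \<sigma> \<Delta> x r p q y = A * y + \<mu> * B"
proof -
  let ?X = "igbm_X \<tau> \<sigma> \<Delta> x" and ?\<alpha> = "igbm_alpha \<tau> \<sigma> \<Delta> x"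
  have X: "?X > 0"
    by (simp add: igbm_X_def)
  have \<alpha>: "?\<alpha> > 0"
    unfolding igbm_alpha_def by (rule exp_minus_one_quotient_pos[OF assms(2)])
  note pos = X \<alpha> assms(1) log_ode_factor_pos[OF assms(1), of \<sigma> r]
  show thesis
  proof (cases s)
    case L1
    show ?thesis
      by (rule that[of ?X "?X * \<Delta>"]) (use L1 pos in \<open>simp_all add: algebra_simps\<close>)
  next
    case L2
    show ?thesis
      by (rule that[of ?X \<Delta>]) (use L2 pos in \<open>simp_all add: algebra_simps\<close>)
  next
    case S1
    show ?thesis
      by (rule that[of ?X "\<Delta> / 2 * ?X + \<Delta> / 2"])
        (use S1 pos in \<open>simp_all add: algebra_simps add_pos_pos\<close>)
  next
    case S2
    show ?thesis
      by (rule that[of "exp (- (1 / \<tau> + \<sigma>\<^sup>2 / 2) * \<Delta> + \<sigma> * (p + q))"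
            "\<Delta> * exp (- (1 / \<tau> + \<sigma>\<^sup>2 / 2) * \<Delta> / 2 + \<sigma> * q)"])
        (use S2 pos in \<open>simp_all add: mult.commute mult.left_commute\<close>)
  next
    case Lin
    show ?thesis
      by (rule that[of ?X "\<Delta> * ?\<alpha>"]) (use Lin pos in \<open>simp_all add: mult.commute\<close>)
  next
    case Log
    show ?thesis
      \<comment> \<open>Only products are reordered, so the last factor keeps the shape in which
        \<open>log_ode_factor_pos\<close> provides its positivity.\<close>
      by (rule that[of ?X "\<Delta> * ?\<alpha> * (1 - \<sigma> * r + \<sigma>\<^sup>2 * (3 / 5 * r\<^sup>2 + \<Delta> / 30))"])
        (use Log pos in \<open>simp_all only: igbm_step.simps mult_pos_pos mult.assoc mult.commute[of _ ?X]\<close>)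
  qed
qed

text \<open>The disjunction makes one of the terms \<open>A * y\<close> and \<open>\<mu> * B\<close>
  strictly positive. This treats the unattainable and the entrance property together.\<close>

lemma igbm_step_pos:
  assumes "\<Delta> > 0" and "- (1 / \<tau> + \<sigma>\<^sup>2 / 2) * \<Delta> + \<sigma> * x \<noteq> 0"
    and "\<mu> \<ge> 0" and "y \<ge> 0" and "\<mu> > 0 \<or> y > 0"
  shows "igbm_step s \<tau> \<mu> \<sigma> \<Delta> x r p q y > 0"
proof -
  obtain A B where "A > 0" "B > 0"
    "\<And>\<mu> y. igbm_step s \<tau> \<mu> \<sigma> \<Delta> x r p q y = A * y + \<mu> * B"
    by (rule igbm_step_affine[OF assms(1,2)]) blast
  then show ?thesis
    using assms(3-5) by (auto intro: add_pos_nonneg add_nonneg_pos)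
qed

text \<open>The step is linear in the pair (\<mu>, y). This reflection turns the exit property into
  the positive case.\<close>

lemma igbm_step_minus:
  "igbm_step s \<tau> (- \<mu>) \<sigma> \<Delta> x r p q (- y) = - igbm_step s \<tau> \<mu> \<sigma> \<Delta> x r p q y"
  by (cases s) (simp_all add: algebra_simps)

lemma igbm_step_neg:
  assumes "\<Delta> > 0" and "- (1 / \<tau> + \<sigma>\<^sup>2 / 2) * \<Delta> + \<sigma> * x \<noteq> 0" and "\<mu> < 0" and "y \<le> 0"
  shows "igbm_step s \<tau> \<mu> \<sigma> \<Delta> x r p q y < 0"
  using igbm_step_pos[OF assms(1,2), of "- \<mu>" "- y" s r p q] assms(3,4)
  by (simp add: igbm_step_minus)

lemma igbm_step_zero: "igbm_step s \<tau> 0 \<sigma> \<Delta> x r p q 0 = 0"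
  by (cases s) simp_all

text \<open>A law with a Lebesgue density has no atoms, since singletons are Lebesgue null
  sets.\<close>

lemma distributed_lborel_AE_neq:
  fixes X :: "'a \<Rightarrow> real"
  assumes "distributed M lborel X f"
  shows "AE \<omega> in M. X \<omega> \<noteq> c"
proof -
  have "AE x in lborel. 0 < f x \<longrightarrow> x \<noteq> c"
    using AE_lborel_singleton[of c] by eventually_elim simp
  then have "AE x in distr M lborel X. x \<noteq> c"
    unfolding distributed_distr_eq_density[OF assms]
      AE_density[OF distributed_borel_measurable[OF assms]] .
  then show ?thesis
    by (rule AE_distrD[OF distributed_measurable[OF assms]])
qed

context igbm_noise
begin

text \<open>Makes the sign conditions events, so that almost sure statements become statements of
  probability 1.\<close>

lemma igbm_next_measurable [measurable]:
  "igbm_next s \<tau> \<mu> \<sigma> \<Delta> \<xi> \<rho> \<phi> \<psi> i y \<in> borel_measurable M"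
proof -
  have [measurable]: "\<xi> i \<in> borel_measurable M" "\<rho> i \<in> borel_measurable M"
    "\<phi> i \<in> borel_measurable M" "\<psi> i \<in> borel_measurable M"
    using xi_normal[of i] rho_normal[of i] phi_normal[of i] psi_normal[of i]
    by (simp_all add: distributed_def)
  show ?thesis
    unfolding igbm_next_def
    by (cases s) (simp_all add: igbm_X_def igbm_alpha_def)
qed

lemma AE_igbm_exponent_nonzero:
  assumes "\<sigma> > 0"
  shows "AE \<omega> in M. - (1 / \<tau> + \<sigma>\<^sup>2 / 2) * \<Delta> + \<sigma> * \<xi> i \<omega> \<noteq> 0"
  \<comment> \<open>The excluded value is the unique zero of the exponent as a function of the
    increment.\<close>
  using distributed_lborel_AE_neq[OF xi_normal, of i "(1 / \<tau> + \<sigma>\<^sup>2 / 2) * \<Delta> / \<sigma>"]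
proof eventually_elim
  case (elim \<omega>)
  then show ?case
    using assms by (simp add: eq_divide_eq) argo
qed

lemma prob_igbm_next_pos:
  assumes "\<sigma> > 0" and "\<Delta> > 0" and "\<mu> \<ge> 0" and "y \<ge> 0" and "\<mu> > 0 \<or> y > 0"
  shows "\<P>(\<omega> in M. igbm_next s \<tau> \<mu> \<sigma> \<Delta> \<xi> \<rho> \<phi> \<psi> i y \<omega> > 0) = 1"
proof -
  have "AE \<omega> in M. igbm_next s \<tau> \<mu> \<sigma> \<Delta> \<xi> \<rho> \<phi> \<psi> i y \<omega> > 0"
    using AE_igbm_exponent_nonzero[OF assms(1)]
    by eventually_elim (use assms in \<open>auto simp: igbm_next_def intro!: igbm_step_pos\<close>)
  then show ?thesis
    by (subst prob_Collect_eq_1) measurable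
qed

lemma prob_igbm_next_neg:
  assumes "\<sigma> > 0" and "\<Delta> > 0" and "\<mu> < 0" and "y \<le> 0"
  shows "\<P>(\<omega> in M. igbm_next s \<tau> \<mu> \<sigma> \<Delta> \<xi> \<rho> \<phi> \<psi> i y \<omega> < 0) = 1"
proof -
  have "AE \<omega> in M. igbm_next s \<tau> \<mu> \<sigma> \<Delta> \<xi> \<rho> \<phi> \<psi> i y \<omega> < 0"
    using AE_igbm_exponent_nonzero[OF assms(1)]
    by eventually_elim (use assms in \<open>auto simp: igbm_next_def intro!: igbm_step_neg\<close>)
  then show ?thesis
    by (subst prob_Collect_eq_1) measurable
qed

end

theorem proposition3:
  fixes M :: "'a measure"
    and \<tau> \<mu> \<sigma> \<Delta> :: real
    and Y0 :: "'a \<Rightarrow> real"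
    and \<xi> \<rho> \<phi> \<psi> :: "nat \<Rightarrow> 'a \<Rightarrow> real"
    and s :: igbm_scheme
  assumes "\<tau> > 0" and "\<sigma> > 0" and "\<Delta> > 0"
    and "igbm_noise M \<Delta> Y0 \<xi> \<rho> \<phi> \<psi>"
  shows "(\<mu> \<ge> 0 \<longrightarrow> (\<forall>i\<ge>1. \<forall>y>0.
            \<P>(\<omega> in M. igbm_next s \<tau> \<mu> \<sigma> \<Delta> \<xi> \<rho> \<phi> \<psi> (i - 1) y \<omega> > 0) = 1))
       \<and> (\<mu> = 0 \<longrightarrow>
            \<P>(\<omega> in M. igbm_numsol s \<tau> \<mu> \<sigma> \<Delta> \<xi> \<rho> \<phi> \<psi> (\<lambda>_. 0) 1 \<omega> = 0) = 1)
       \<and> (\<mu> > 0 \<longrightarrow>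
            \<P>(\<omega> in M. igbm_numsol s \<tau> \<mu> \<sigma> \<Delta> \<xi> \<rho> \<phi> \<psi> (\<lambda>_. 0) 1 \<omega> > 0) = 1)
       \<and> (\<mu> < 0 \<longrightarrow> (\<forall>i\<ge>1. \<forall>y\<le>0.
            \<P>(\<omega> in M. igbm_next s \<tau> \<mu> \<sigma> \<Delta> \<xi> \<rho> \<phi> \<psi> (i - 1) y \<omega> < 0) = 1))"
proof -
  interpret igbm_noise M \<Delta> Y0 \<xi> \<rho> \<phi> \<psi>
    by (fact assms(4))
  \<comment> \<open>From the initial value 0, the first iterate is the transition from state 0, so
    the transition lemmas apply with \<open>y = 0\<close>.\<close>
  have one: "igbm_numsol s \<tau> \<mu> \<sigma> \<Delta> \<xi> \<rho> \<phi> \<psi> (\<lambda>_. 0) 1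
      = igbm_next s \<tau> \<mu> \<sigma> \<Delta> \<xi> \<rho> \<phi> \<psi> 0 0"
    by (rule ext) simp
  show ?thesis
    unfolding one
    \<comment> \<open>Absorption needs no null set: by \<open>igbm_step_zero\<close> the value is 0
      at every outcome, so the event is the whole space.\<close>
    using prob_igbm_next_pos[OF assms(2,3)] prob_igbm_next_neg[OF assms(2,3)]
    by (auto simp: igbm_next_def igbm_step_zero prob_space)
qed

end
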